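(* Let $(\alpha,\beta)\subseteq(0,1)$ with $3\beta^2>1$ and $3\alpha^2<1$, let $\psi:\mathbb{R}\to\mathbb{R}$ be a twice continuously differentiable function supported in $(\alpha,\beta)$ (i.e. vanishing outside $(\alpha,\beta)$), and let $f:\mathbb{R}\to\mathbb{R}$ be any smooth function. Define $$h(x,u)=\psi(x_1)\,\psi(x_2)\,\psi(x_3)\,f(u),\qquad x=(x_1,x_2,x_3)\in\mathbb{R}^3,\ u\in\mathbb{R},$$ and let $F(x,u)=n(x)\times\nabla_x h(x,u)$, $x\in\mathbb{S}^2$, be the associated gradient flux vector. Let $D\subseteq\mathbb{S}^2$ be the spherical patch $$D=\{x\in\mathbb{S}^2:\ \alpha<x_i<\beta,\ i=1,2,3\}.$$ If the initial data $u_0$ is supported in $D$ (i.e. vanishes outside $D$), then the entropy solution $u=u(x,t)$ of the initial value problem $$\frac{\partial u}{\partial t}+\nabla_T\cdot\big(F(x,u)\big)=0\ \text{ on }\mathbb{S}^2\times[0,\infty),\qquad u(x,0)=u_0(x),$$ is supported in $D$ (i.e. vanishes outside $D$) for all $t\ge 0$.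
   Context: $\mathbb{S}^2$ is the unit sphere in $\mathbb{R}^3$, $n(x)=x$ is the outward unit normal at $x\in\mathbb{S}^2$, $\times$ is the cross product, $\nabla_x$ is the Euclidean gradient in $x\in\mathbb{R}^3$, and $\nabla_T\cdot$ (resp. $\nabla_T$) is the tangential divergence (resp. gradient) on $\mathbb{S}^2$ with the round metric. Solutions are understood in the usual Kruzkov entropy sense, for bounded measurable initial data and with functions identified up to null sets: $u\in L^\infty(\mathbb{S}^2\times(0,T))$ for every $T>0$ and, for every $k\in\mathbb{R}$ and every nonnegative smooth compactly supported test function $\theta$ on $\mathbb{S}^2\times[0,\infty)$, $$\int_0^\infty\!\!\int_{\mathbb{S}^2}\Big(|u-k|\,\partial_t\theta+\operatorname{sgn}(u-k)\big(F(x,u)-F(x,k)\big)\cdot\nabla_T\theta\Big)\,d\sigma\,dt+\int_{\mathbb{S}^2}|u_0-k|\,\theta(x,0)\,d\sigma\ \ge 0 .$$ (Here the flux is divergence-free in $x$ for each fixed $u$.) *)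

theory Defs
  imports "HOL-Analysis.Analysis"
begin

section \<open>Differentiable functions and the gradient flux\<close>

text \<open>\<open>C_diff k g\<close>: the real function \<open>g\<close> is of class \<open>C\<^sup>k\<close> on the whole space. In finite
  dimension, being differentiable with directional derivatives of class \<open>C\<^sup>k\<close> in every
  direction is the same as being of class \<open>C\<^sup>k\<^sup>+\<^sup>1\<close>.\<close>

primrec C_diff :: "nat \<Rightarrow> ('a::euclidean_space \<Rightarrow> real) \<Rightarrow> bool" where
  "C_diff 0 g \<longleftrightarrow> continuous_on UNIV g"
| "C_diff (Suc k) g \<longleftrightarrow>
     (\<forall>x. g differentiable (at x)) \<and> (\<forall>v. C_diff k (\<lambda>x. frechet_derivative g (at x) v))"

definition smooth :: "('a::euclidean_space \<Rightarrow> real) \<Rightarrow> bool" where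
  "smooth g \<longleftrightarrow> (\<forall>k. C_diff k g)"

definition grad :: "('a::real_inner \<Rightarrow> real) \<Rightarrow> 'a \<Rightarrow> 'a" where
  "grad g x = (THE d. GDERIV g x :> d)"

abbreviation S2 :: "(real^3) set" where
  "S2 \<equiv> sphere 0 1"

definition unit_normal :: "real^3 \<Rightarrow> real^3" where
  "unit_normal x = x"

definition gradient_flux :: "(real^3 \<Rightarrow> real \<Rightarrow> real) \<Rightarrow> real^3 \<Rightarrow> real \<Rightarrow> real^3" where
  "gradient_flux h x u = cross3 (unit_normal x) (grad (\<lambda>y. h y u) x)"

text \<open>The tangential gradient on \<open>S2\<close> of (the restriction of) a function defined on the ambient
  space: it depends only on the values of \<open>g\<close> on the sphere.\<close>

definition tangential_grad :: "(real^3 \<Rightarrow> real) \<Rightarrow> real^3 \<Rightarrow> real^3" where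
  "tangential_grad g x = grad g x - (unit_normal x \<bullet> grad g x) *\<^sub>R unit_normal x"

section \<open>Surface measure\<close>

text \<open>The surface measure of \<open>A \<subseteq> S2\<close> is three times the volume of the punctured cone
  \<open>{r x | 0 < r < 1, x \<in> A}\<close>, because \<open>dx = r\<^sup>2 dr d\<sigma>\<close> in polar coordinates.\<close>

definition sphere_measure :: "(real^3) measure" where
  "sphere_measure = scale_measure 3
     (distr (restrict_space lborel (ball 0 1 - {0})) (restrict_space borel S2) (\<lambda>x. x /\<^sub>R norm x))"

abbreviation time_measure :: "real measure" where
  "time_measure \<equiv> restrict_space lborel {0<..}"

section \<open>Kruzkov entropy solutions\<close>

text \<open>Functions are Borel representatives of classes modulo null sets.\<close>

definition bounded_measurable_initial_data :: "(real^3 \<Rightarrow> real) \<Rightarrow> bool" where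
  "bounded_measurable_initial_data u0 \<longleftrightarrow>
     u0 \<in> borel_measurable sphere_measure \<and> (\<exists>C. AE x in sphere_measure. \<bar>u0 x\<bar> \<le> C)"

definition locally_bounded_in_time :: "(real^3 \<Rightarrow> real \<Rightarrow> real) \<Rightarrow> bool" where
  "locally_bounded_in_time u \<longleftrightarrow>
     (\<lambda>(x, t). u x t) \<in> borel_measurable (sphere_measure \<Otimes>\<^sub>M time_measure) \<and>
     (\<forall>T>0. \<exists>C. AE (x, t) in sphere_measure \<Otimes>\<^sub>M time_measure. t < T \<longrightarrow> \<bar>u x t\<bar> \<le> C)"

text \<open>Smooth functions on the closed submanifold with boundary \<open>S2 \<times> [0, \<infinity>)\<close> are exactly the
  restrictions of smooth functions on \<open>\<real>\<^sup>3 \<times> \<real>\<close>. Sign and support conditions concern the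
  restriction only. As \<open>S2\<close> is compact, compact support means vanishing for large times (in
  particular, test functions need not vanish at \<open>t = 0\<close>).\<close>

definition nonneg_test_function :: "(real^3 \<Rightarrow> real \<Rightarrow> real) \<Rightarrow> bool" where
  "nonneg_test_function \<theta> \<longleftrightarrow>
     smooth (\<lambda>(x, t). \<theta> x t) \<and>
     (\<forall>x\<in>S2. \<forall>t\<ge>0. 0 \<le> \<theta> x t) \<and>
     (\<exists>T. \<forall>x\<in>S2. \<forall>t\<ge>T. \<theta> x t = 0)"

definition entropy_solution ::
    "(real^3 \<Rightarrow> real \<Rightarrow> real^3) \<Rightarrow> (real^3 \<Rightarrow> real) \<Rightarrow> (real^3 \<Rightarrow> real \<Rightarrow> real) \<Rightarrow> bool" where
  "entropy_solution F u0 u \<longleftrightarrow>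
     locally_bounded_in_time u \<and>
     (\<forall>k \<theta>. nonneg_test_function \<theta> \<longrightarrow>
        (LINT t|time_measure. LINT x|sphere_measure.
            \<bar>u x t - k\<bar> * deriv (\<lambda>s. \<theta> x s) t
            + (sgn (u x t - k) *\<^sub>R (F x (u x t) - F x k)) \<bullet> tangential_grad (\<lambda>y. \<theta> y t) x)
        + (LINT x|sphere_measure. \<bar>u0 x - k\<bar> * \<theta> x 0) \<ge> 0)"

text \<open>An entropy solution is a class modulo null sets of \<open>S2 \<times> (0, \<infinity>)\<close>; its value at a single
  time is that of a representative which is continuous from \<open>[0, \<infinity>)\<close> into \<open>L\<^sup>1(S2)\<close>.\<close>

definition L1_continuous_representative ::
    "(real^3 \<Rightarrow> real \<Rightarrow> real) \<Rightarrow> (real^3 \<Rightarrow> real \<Rightarrow> real) \<Rightarrow> bool" where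
  "L1_continuous_representative u v \<longleftrightarrow>
     (AE (x, t) in sphere_measure \<Otimes>\<^sub>M time_measure. v x t = u x t) \<and>
     (\<forall>t\<ge>0. integrable sphere_measure (\<lambda>x. v x t)) \<and>
     (\<forall>t\<ge>0. ((\<lambda>s. LINT x|sphere_measure. \<bar>v x s - v x t\<bar>) \<longlongrightarrow> 0) (at t within {0..}))"

definition spherical_patch :: "real \<Rightarrow> real \<Rightarrow> (real^3) set" where
  "spherical_patch \<alpha> \<beta> = {x \<in> S2. \<forall>i. \<alpha> < x $ i \<and> x $ i < \<beta>}"

end

theory Submission
  imports Defs
begin

text \<open>
  Since \<open>\<psi>\<close> is differentiable and vanishes outside \<open>(\<alpha>, \<beta>)\<close>, both \<open>\<psi>\<close> and \<open>\<psi>'\<close> vanish there, so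
  \<open>F(x, \<cdot>) = 0\<close> for \<open>x \<in> S2 - D\<close>. Take \<open>k = 0\<close> and a test function \<open>\<phi>(x) \<chi>(t)\<close> with \<open>\<phi> \<ge> 0\<close> vanishing
  on \<open>D\<close>: the flux term disappears, because \<open>F\<close> vanishes outside \<open>D\<close> and \<open>\<nabla>\<phi>\<close> on \<open>D\<close>, and so does
  the initial term. If \<open>\<chi>' < 0\<close> on \<open>(0, T)\<close>, what is left of the entropy inequality,
  \<open>\<integral>\<integral> \<bar>u\<bar> \<phi> \<chi>' \<ge> 0\<close>, forces \<open>u = 0\<close> almost everywhere on \<open>{\<phi> > 0}\<close> up to time \<open>T\<close>. Letting \<open>\<phi>\<close>
  range over flat functions of \<open>\<alpha> - x\<^sub>i\<close> and \<open>x\<^sub>i - \<beta>\<close> covers \<open>S2 - D\<close> up to the circles \<open>x\<^sub>i = \<alpha>\<close>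
  and \<open>x\<^sub>i = \<beta>\<close>, which are null sets.
\<close>

section \<open>A smooth test function with prescribed support\<close>

text \<open>Dividing by powers of \<open>t\<close> closes the family under differentiation up to linear combinations.\<close>

definition flat_exp :: "nat \<Rightarrow> real \<Rightarrow> real" where
  "flat_exp n t = (if t > 0 then exp (- (1 / t)) / t ^ n else 0)"

lemma flat_exp_nonneg: "0 \<le> flat_exp n t"
  by (simp add: flat_exp_def)

lemma flat_exp_eq_0_iff: "flat_exp n t = 0 \<longleftrightarrow> t \<le> 0"
  by (auto simp: flat_exp_def)

text \<open>In the variable y = 1/t this is the decay of y^n / exp y at infinity.\<close>

lemma flat_exp_tendsto_0_right: "(flat_exp n \<longlongrightarrow> 0) (at_right 0)"
proof -
  have "((\<lambda>t::real. inverse t ^ n / exp (inverse t)) \<longlongrightarrow> 0) (at_right 0)"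
    by (rule filterlim_compose[OF tendsto_power_div_exp_0 filterlim_inverse_at_top_right])
  moreover have "\<forall>\<^sub>F t in at_right 0. inverse t ^ n / exp (inverse t) = flat_exp n t"
    unfolding eventually_at_right_field
    by (intro exI[of _ 1]) (auto simp: flat_exp_def exp_minus field_simps)
  ultimately show ?thesis
    by (rule Lim_transform_eventually)
qed

text \<open>Differentiating the exponential raises the power of 1/t by 2, differentiating the power
  raises it by 1. Only the point 0 needs a limit.\<close>

lemma DERIV_flat_exp:
  "(flat_exp n has_real_derivative flat_exp (n + 2) t - real n * flat_exp (n + 1) t) (at t)"
proof -
  consider "t > 0" | "t < 0" | "t = 0" by linarith
  then show ?thesis
  proof cases
    case 1
    \<comment> \<open>For n = 0 the truncated exponent is harmless, as the factor
      \<open>real n\<close> vanishes.\<close>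
    have "real n * t ^ (n - Suc 0) = real n * t ^ n / t"
      using 1 by (cases n) auto
    then have "((\<lambda>s. exp (- (1 / s)) / s ^ n) has_real_derivative
        flat_exp (n + 2) t - real n * flat_exp (n + 1) t) (at t)"
      using 1
      by (auto intro!: derivative_eq_intros simp: flat_exp_def field_simps power2_eq_square)
    then show ?thesis
      by (rule DERIV_cong_ev[THEN iffD1, rotated -1])
        (use 1 in \<open>auto intro!: eventually_mono[OF eventually_nhds_in_open[of "{0<..}"]]
          simp: flat_exp_def\<close>)
  next
    case 2
    have "((\<lambda>s. 0) has_real_derivative flat_exp (n + 2) t - real n * flat_exp (n + 1) t) (at t)"
      using 2 by (simp add: flat_exp_def)
    then show ?thesis
      by (rule DERIV_cong_ev[THEN iffD1, rotated -1])
        (use 2 in \<open>auto intro!: eventually_mono[OF eventually_nhds_in_open[of "{..<0}"]]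
          simp: flat_exp_def\<close>)
  next
    case 3
    \<comment> \<open>The difference quotient at 0 is zero on the left and
      \<open>flat_exp (n + 1) s\<close> on the right.\<close>
    have "((\<lambda>s. flat_exp n s / s) \<longlongrightarrow> 0) (at 0)"
    proof (rule filterlim_split_at)
      show "((\<lambda>s. flat_exp n s / s) \<longlongrightarrow> 0) (at_left 0)"
        by (rule Lim_transform_eventually[OF tendsto_const])
          (auto simp: eventually_at_left_field flat_exp_def intro: exI[of _ "-1"])
      show "((\<lambda>s. flat_exp n s / s) \<longlongrightarrow> 0) (at_right 0)"
        by (rule Lim_transform_eventually[OF flat_exp_tendsto_0_right[of "n + 1"]])
          (auto simp: eventually_at_right_field flat_exp_def field_simps intro: exI[of _ 1])
    qed
    then show ?thesis
      using 3 by (simp add: DERIV_def flat_exp_def)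
  qed
qed

section \<open>Linear combinations of functions of class C^k, and smoothness of the flat
  products\<close>

lemma C_diff_cmult: "C_diff k g \<Longrightarrow> C_diff k (\<lambda>x. c * g x)"
proof (induction k arbitrary: g)
  case 0
  then show ?case by (simp add: continuous_on_mult)
next
  case (Suc k)
  then have "frechet_derivative (\<lambda>x. c * g x) (at x) = (\<lambda>v. c * frechet_derivative g (at x) v)" for x
    by (intro frechet_derivative_at[symmetric] has_derivative_mult_right)
      (simp add: frechet_derivative_works[symmetric])
  with Suc show ?case
    by (simp add: differentiable_mult)
qed

lemma C_diff_add: "C_diff k f \<Longrightarrow> C_diff k g \<Longrightarrow> C_diff k (\<lambda>x. f x + g x)"
proof (induction k arbitrary: f g)
  case 0
  then show ?case by (simp add: continuous_on_add)
next
  case (Suc k)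
  then have "frechet_derivative (\<lambda>x. f x + g x) (at x)
      = (\<lambda>v. frechet_derivative f (at x) v + frechet_derivative g (at x) v)" for x
    by (intro frechet_derivative_at[symmetric] has_derivative_add)
      (simp_all add: frechet_derivative_works[symmetric])
  with Suc show ?case
    by simp
qed

text \<open>The induction works for all m and n at once: a directional derivative of such a product
  is a linear combination of four products with raised indices, since the affine arguments
  contribute only the constants a \<bullet> v and c \<bullet> v. The space 'a will be the product of
  space and time.\<close>

lemma C_diff_flat_exp_product:
  fixes a c :: "'a::euclidean_space"
  shows "C_diff k (\<lambda>z. flat_exp m (a \<bullet> z + b) * flat_exp n (c \<bullet> z + d))"
proof (induction k arbitrary: m n)
  have *: "((\<lambda>z. flat_exp n (a \<bullet> z + b)) has_derivative
      (\<lambda>v. (a \<bullet> v) * (flat_exp (n + 2) (a \<bullet> z + b) - real n * flat_exp (n + 1) (a \<bullet> z + b)))) (at z)"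
    for n and a z :: 'a and b
    by (rule has_derivative_eq_rhs[OF has_derivative_compose[OF _
          DERIV_flat_exp[unfolded has_field_derivative_def], where f = "\<lambda>z. a \<bullet> z + b"]])
      (auto intro!: derivative_eq_intros)
  note deriv = has_derivative_mult[OF * *]
  {
    case 0
    show ?case
      using deriv by (auto intro!: continuous_at_imp_continuous_on has_derivative_continuous)
  next
    case (Suc k)
    let ?P = "\<lambda>m n z. flat_exp m (a \<bullet> z + b) * flat_exp n (c \<bullet> z + d)"
    have "frechet_derivative (?P m n) (at z) v =
        ((c \<bullet> v) * ?P m (n + 2) z + (- (c \<bullet> v) * real n) * ?P m (n + 1) z) +
        ((a \<bullet> v) * ?P (m + 2) n z + (- (a \<bullet> v) * real m) * ?P (m + 1) n z)" for z v
      unfolding frechet_derivative_at[OF deriv, symmetric] by (simp add: algebra_simps)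
    moreover have "?P m n differentiable (at z)" for z
      using deriv unfolding differentiable_def by blast
    ultimately show ?case
      by (simp only: C_diff.simps) (intro conjI allI TrueI C_diff_add C_diff_cmult Suc)
  }
qed

text \<open>A test function that is positive exactly on the open half-space a \<bullet> x + b > 0
  before time T and decreases strictly in t there. It stays positive at t = 0 when T > 0, so the
  initial term must be dealt with separately.\<close>

definition cutoff :: "real^3 \<Rightarrow> real \<Rightarrow> real \<Rightarrow> real^3 \<Rightarrow> real \<Rightarrow> real" where
  "cutoff a b T x t = flat_exp 0 (a \<bullet> x + b) * flat_exp 0 (T - t)"

lemma nonneg_test_function_cutoff: "nonneg_test_function (cutoff a b T)"
proof -
  have "smooth (\<lambda>(x, t). cutoff a b T x t)"
    unfolding smooth_def
    using C_diff_flat_exp_product[of _ 0 "(a, 0)" b 0 "(0, - 1 :: real)" T]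
    by (simp add: cutoff_def case_prod_beta' inner_prod_def inner_real_def)
  moreover have "\<exists>S. \<forall>x\<in>S2. \<forall>t\<ge>S. cutoff a b T x t = 0"
    by (intro exI[of _ T]) (auto simp: cutoff_def flat_exp_def)
  ultimately show ?thesis
    by (auto simp: nonneg_test_function_def cutoff_def flat_exp_nonneg)
qed

text \<open>The index 0 removes the second term of \<open>DERIV_flat_exp\<close>; the sign comes
  from the argument T - t and drives the whole argument.\<close>

lemma deriv_cutoff:
  "deriv (cutoff a b T x) t = - (flat_exp 0 (a \<bullet> x + b) * flat_exp 2 (T - t))"
proof -
  have "((\<lambda>s. flat_exp 0 (T - s)) has_real_derivative - flat_exp 2 (T - t)) (at t)"
    using DERIV_chain2[where f = "flat_exp 0" and g = "\<lambda>s. T - s" and x = t and s = UNIV,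
        OF DERIV_flat_exp, of "- 1"]
    by (simp add: numeral_2_eq_2 DERIV_cong[OF DERIV_diff[OF DERIV_const DERIV_ident]])
  from DERIV_cmult[OF this, of "flat_exp 0 (a \<bullet> x + b)"] show ?thesis
    unfolding cutoff_def by (intro DERIV_imp_deriv) simp
qed

lemma grad_eqI: "GDERIV g x :> d \<Longrightarrow> grad g x = d"
proof -
  assume d: "GDERIV g x :> d"
  have "d' = d" if "GDERIV g x :> d'" for d'
    using has_derivative_unique[OF d[unfolded gderiv_def] that[unfolded gderiv_def]]
    by (metis inner_commute vector_eq_rdot)
  with d show ?thesis
    unfolding grad_def by blast
qed

text \<open>The profile is flat up to and including 0, so the full Euclidean gradient vanishes on
  the closed half-space.\<close>

lemma tangential_grad_cutoff_eq_0:
  assumes "a \<bullet> x + b \<le> 0"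
  shows "tangential_grad (\<lambda>y. cutoff a b T y t) x = 0"
proof -
  have "flat_exp 2 (a \<bullet> x + b) = 0"
    using assms by (simp add: flat_exp_eq_0_iff)
  then have "(flat_exp 0 has_derivative (\<lambda>v. 0)) (at (a \<bullet> x + b))"
    using DERIV_flat_exp[of 0 "a \<bullet> x + b"] by (simp add: has_field_derivative_def numeral_2_eq_2 lambda_zero)
  then have "((\<lambda>y. flat_exp 0 (a \<bullet> y + b)) has_derivative (\<lambda>v. 0)) (at x)"
    by (rule has_derivative_compose[where f = "\<lambda>y. a \<bullet> y + b", rotated])
      (auto intro!: derivative_eq_intros)
  then have "GDERIV (\<lambda>y. cutoff a b T y t) x :> 0"
    unfolding gderiv_def cutoff_def by (auto intro!: derivative_eq_intros)
  then show ?thesis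
    by (simp add: tangential_grad_def grad_eqI)
qed

section \<open>Vanishing of the flux outside the patch\<close>

text \<open>The case that matters is an endpoint of the interval: a derivative is already determined
  by its one-sided limit from the side where \<psi> vanishes.\<close>

lemma DERIV_0_if_vanishes_outside_interval:
  fixes \<psi> :: "real \<Rightarrow> real"
  assumes zero: "\<forall>s. s \<notin> {\<alpha><..<\<beta>} \<longrightarrow> \<psi> s = 0" and "\<psi> differentiable (at s)" "s \<notin> {\<alpha><..<\<beta>}"
  shows "(\<psi> has_real_derivative 0) (at s)"
proof -
  obtain d where d: "(\<psi> has_real_derivative d) (at s)"
    using assms(2) by (auto simp: real_differentiable_def)
  \<comment> \<open>A half-line with endpoint s on which \<psi> is zero; if s > \<alpha>, then s
    lies at or beyond \<beta>.\<close>
  define S where "S = (if s \<le> \<alpha> then {..s} else {s..})"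
  have z: "\<psi> x = 0" if "x \<in> S" for x
    using that zero assms(3) by (auto simp: S_def split: if_splits)
  have "at s within S \<noteq> bot"
    using at_le[of "{..<s}" S s] at_le[of "{s<..}" S s] trivial_limit_at_left_real[of s]
      trivial_limit_at_right_real[of s]
    by (auto simp: S_def bot_unique subset_iff split: if_splits)
  moreover have "(\<psi> has_vector_derivative d) (at s within S)"
    using d by (simp add: has_real_derivative_iff_has_vector_derivative
        has_vector_derivative_at_within)
  moreover have "(\<psi> has_vector_derivative 0) (at s within S)"
    by (rule has_vector_derivative_transform[OF _ _ has_vector_derivative_const[of 0]])
      (auto simp: z, simp add: S_def)
  ultimately have "d = 0"
    by (rule vector_derivative_unique_within)
  with d show ?thesis by simp
qed

text \<open>Some coordinate x $ i lies outside (\<alpha>, \<beta>), and every term of the product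
  rule contains \<psi> or its derivative at that coordinate.\<close>

lemma gradient_flux_eq_0:
  assumes "\<forall>s. \<psi> differentiable (at s)" "\<forall>s. s \<notin> {\<alpha><..<\<beta>} \<longrightarrow> \<psi> s = 0"
    and h: "\<forall>x u. h x u = \<psi> (x $ 1) * \<psi> (x $ 2) * \<psi> (x $ 3) * f u"
    and x: "x \<in> S2" "x \<notin> spherical_patch \<alpha> \<beta>"
  shows "gradient_flux h x u = 0"
proof -
  obtain i where i: "x $ i \<notin> {\<alpha><..<\<beta>}"
    using x by (auto simp: spherical_patch_def)
  obtain d where d: "\<And>s. (\<psi> has_real_derivative d s) (at s)"
    using assms(1) unfolding real_differentiable_def by metis
  have \<psi>i: "\<psi> (x $ i) = 0" "d (x $ i) = 0"
    using DERIV_0_if_vanishes_outside_interval[OF assms(2) _ i] assms i d DERIV_unique by blast+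
  have *: "((\<lambda>y. \<psi> (y $ j)) has_derivative (\<lambda>v. d (x $ j) * v $ j)) (at x)" for j
    by (rule has_derivative_compose[OF _ d[unfolded has_field_derivative_def],
          where f = "\<lambda>y. y $ j"]) (rule bounded_linear_imp_has_derivative[OF bounded_linear_vec_nth])
  have "GDERIV (\<lambda>y. h y u) x :> 0"
    unfolding gderiv_def h[rule_format]
    by (rule has_derivative_eq_rhs[OF has_derivative_mult_left[OF
            has_derivative_mult[OF has_derivative_mult[OF * *] *]]])
      (use \<psi>i exhaust_3[of i] in auto)
  then show ?thesis
    by (simp add: gradient_flux_def grad_eqI)
qed

section \<open>The surface measure\<close>

lemma measurable_sphere_projection:
  "(\<lambda>x. x /\<^sub>R norm x) \<in>
     measurable (restrict_space lborel (ball 0 1 - {0})) (restrict_space borel S2)"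
proof (rule measurable_restrict_space2)
  show "(\<lambda>x. x /\<^sub>R norm x) \<in> space (restrict_space lborel (ball 0 1 - {0})) \<rightarrow> S2"
    by (auto simp: space_restrict_space)
  show "(\<lambda>x. x /\<^sub>R norm x) \<in> borel_measurable (restrict_space lborel (ball 0 1 - {0}))"
    by (rule measurable_restrict_space1) measurable
qed

lemma space_sphere_measure [simp]: "space sphere_measure = S2"
  by (simp add: sphere_measure_def space_scale_measure space_restrict_space)

lemma sets_sphere_measure [measurable_cong]: "sets sphere_measure = sets (restrict_space borel S2)"
  by (simp add: sphere_measure_def)

lemma finite_measure_sphere_measure: "finite_measure sphere_measure"
proof
  let ?N = "restrict_space lborel (ball 0 1 - {0 :: real^3})"
  have "emeasure ?N (space ?N) \<le> emeasure lborel (ball 0 1 :: (real^3) set)"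
    by (simp add: space_restrict_space emeasure_restrict_space emeasure_mono)
  also have "\<dots> < \<infinity>"
    by (intro emeasure_bounded_finite) auto
  finally have "emeasure ?N (space ?N) \<noteq> \<infinity>"
    by simp
  moreover have "emeasure (distr ?N (restrict_space borel S2) (\<lambda>x. x /\<^sub>R norm x)) S2
      = emeasure ?N (space ?N)"
    using emeasure_distr[OF measurable_sphere_projection sets.top]
      measurable_space[OF measurable_sphere_projection]
    by (auto simp: space_restrict_space intro!: arg_cong2[where f = emeasure])
  ultimately show "emeasure sphere_measure (space sphere_measure) \<noteq> \<infinity>"
    by (simp add: sphere_measure_def ennreal_mult_eq_top_iff space_scale_measure space_restrict_space)
qed

text \<open>The factor 3 does not change null sets, so null sets on the sphere correspond to
  Lebesgue null cones in the punctured ball.\<close>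

lemma AE_sphere_measure_iff:
  assumes "{x \<in> S2. P x} \<in> sets (restrict_space borel S2)"
  shows "(AE x in sphere_measure. P x) \<longleftrightarrow>
    (AE x in lborel. x \<in> ball 0 1 - {0} \<longrightarrow> P (x /\<^sub>R norm x))"
proof -
  let ?M = "distr (restrict_space lborel (ball 0 1 - {0})) (restrict_space borel S2)
    (\<lambda>x. x /\<^sub>R norm x)"
  have "(AE x in sphere_measure. P x) \<longleftrightarrow> (AE x in ?M. P x)"
    by (simp add: sphere_measure_def eventually_ae_filter null_sets_def space_scale_measure)
  also have "\<dots> \<longleftrightarrow> (AE x in restrict_space lborel (ball 0 1 - {0}). P (x /\<^sub>R norm x))"
    using assms by (intro AE_distr_iff measurable_sphere_projection) (simp add: space_restrict_space)
  also have "\<dots> \<longleftrightarrow> (AE x in lborel. x \<in> ball 0 1 - {0} \<longrightarrow> P (x /\<^sub>R norm x))"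
    by (rule AE_restrict_space_iff) auto
  finally show ?thesis .
qed

section \<open>Circles of latitude are null sets\<close>

lemma negligible_cone_nonneg:
  fixes c :: real and i :: "'n::finite"
  assumes "0 \<le> c" "c < 1"
  shows "negligible {x :: real^'n. x $ i = c * norm x}"
proof (rule negligible_subset)
  \<comment> \<open>The frontier of a convex set is negligible, and for \<open>c \<ge> 0\<close> the solid cone is convex.\<close>
  let ?K = "{x :: real^'n. c * norm x \<le> x $ i}"
  have "convex ?K"
  proof (intro convexI)
    fix x y :: "real^'n" and p q :: real
    assume *: "x \<in> ?K" "y \<in> ?K" "0 \<le> p" "0 \<le> q" "p + q = 1"
    have "c * norm (p *\<^sub>R x + q *\<^sub>R y) \<le> c * (p * norm x + q * norm y)"
      using * norm_triangle_ineq[of "p *\<^sub>R x" "q *\<^sub>R y"] assms by (intro mult_left_mono) auto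
    also have "\<dots> = p * (c * norm x) + q * (c * norm y)"
      by (simp add: algebra_simps)
    also have "\<dots> \<le> p * x $ i + q * y $ i"
      using * by (intro add_mono mult_left_mono) auto
    finally show "p *\<^sub>R x + q *\<^sub>R y \<in> ?K"
      by simp
  qed
  then show "negligible (frontier ?K)"
    by (rule negligible_convex_frontier)
  show "{x. x $ i = c * norm x} \<subseteq> frontier ?K"
  proof
    fix x :: "real^'n" assume "x \<in> {x. x $ i = c * norm x}"
    then have x: "x $ i = c * norm x" by simp
    have "x \<notin> interior ?K"
    proof
      assume "x \<in> interior ?K"
      then obtain e where e: "e > 0" "ball x e \<subseteq> ?K"
        by (auto simp: mem_interior)
      \<comment> \<open>Moving down by e/2 along the axis lowers the coordinate by e/2 but c times
        the norm by at most c * e/2, which is less; hence y leaves the cone.\<close>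
      define y where "y = x - (e / 2) *\<^sub>R axis i 1"
      have "y \<in> ball x e"
        using e by (simp add: y_def dist_norm)
      then have "y \<in> ?K"
        using e by blast
      then have "c * norm y \<le> x $ i - e / 2"
        by (simp add: y_def)
      moreover have "norm x - e / 2 \<le> norm y"
        using norm_triangle_ineq2[of x "(e / 2) *\<^sub>R axis i 1"] e by (simp add: y_def)
      then have "c * (norm x - e / 2) \<le> c * norm y"
        using assms by (intro mult_left_mono)
      ultimately have "e / 2 \<le> c * (e / 2)"
        using x by (simp add: algebra_simps)
      then show False
        using assms e by simp
    qed
    then show "x \<in> frontier ?K"
      using x closure_subset[of ?K] by (auto simp: frontier_def)
  qed
qed

text \<open>Negative c reduces to positive c by reflection in the origin. The second index j ensures
  dimension at least 2: on the line, c = 1 would give a half-line.\<close>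

lemma negligible_cone:
  fixes c :: real and i j :: "'n::finite"
  assumes "i \<noteq> j"
  shows "negligible {x :: real^'n. x $ i = c * norm x}"
proof -
  consider "0 \<le> c" "c < 1" | "- 1 < c" "c < 0" | "1 \<le> \<bar>c\<bar>" by linarith
  then show ?thesis
  proof cases
    case 1
    then show ?thesis by (rule negligible_cone_nonneg)
  next
    case 2
    then have "negligible (uminus ` {x :: real^'n. x $ i = - c * norm x})"
      by (intro negligible_differentiable_image_negligible negligible_cone_nonneg)
        (auto intro!: differentiable_on_minus)
    moreover have "{x. x $ i = c * norm x} \<subseteq> uminus ` {x :: real^'n. x $ i = - c * norm x}"
      by (auto intro!: image_eqI[of _ uminus "- _"])
    ultimately show ?thesis
      by (rule negligible_subset)
  next
    case 3
    \<comment> \<open>The i-th coordinate already exhausts the norm, so all others vanish and the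
      set lies in a hyperplane.\<close>
    have "x $ j = 0" if x: "x $ i = c * norm x" for x :: "real^'n"
    proof -
      have "(norm x)\<^sup>2 \<le> c\<^sup>2 * (norm x)\<^sup>2"
        using 3 by (intro mult_le_cancel_right1[THEN iffD2]) (auto simp: abs_le_square_iff[of 1 c, simplified])
      also have "\<dots> = (x $ i)\<^sup>2"
        by (simp add: x power_mult_distrib)
      finally have "(\<Sum>k\<in>UNIV. (x $ k)\<^sup>2) \<le> (x $ i)\<^sup>2"
        unfolding power2_norm_eq_inner inner_vec_def by (simp add: power2_eq_square)
      moreover have "(x $ i)\<^sup>2 + (x $ j)\<^sup>2 \<le> (\<Sum>k\<in>UNIV. (x $ k)\<^sup>2)"
        using assms sum_mono2[of UNIV "{i, j}" "\<lambda>k. (x $ k)\<^sup>2"] by simp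
      ultimately have "(x $ j)\<^sup>2 \<le> 0"
        by linarith
      then show ?thesis
        by simp
    qed
    then show ?thesis
      by (intro negligible_subset[OF negligible_standard_hyperplane_cart[of j]]) auto
  qed
qed

text \<open>The cone over the circle x $ i = c is contained in the set x $ i = c * norm x.\<close>

lemma AE_sphere_measure_component_neq: "AE x in sphere_measure. x $ i \<noteq> c"
proof -
  obtain j :: 3 where "i \<noteq> j"
    by (metis exhaust_3 zero_neq_one)
  have "{x :: real^3. x $ i = c * norm x} \<in> null_sets lborel"
    using negligible_cone[OF \<open>i \<noteq> j\<close>, of c]
    by (subst null_sets_completion_iff[symmetric]) (auto simp: negligible_iff_null_sets)
  then have "AE x :: real^3 in lborel. x $ i \<noteq> c * norm x"
    by (auto dest: AE_not_in)
  then have "AE x :: real^3 in lborel. x \<in> ball 0 1 - {0} \<longrightarrow> (x /\<^sub>R norm x) $ i \<noteq> c"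
    by (rule AE_mp) (auto simp: field_simps)
  moreover have "{x \<in> S2. x $ i \<noteq> c} \<in> sets (restrict_space borel S2)"
    by (auto simp: sets_restrict_space_iff)
  ultimately show ?thesis
    by (subst AE_sphere_measure_iff) auto
qed

section \<open>Entropy solutions with a flux supported in the patch\<close>

lemma pair_sigma_finite_sphere_time: "pair_sigma_finite sphere_measure time_measure"
proof -
  interpret finite_measure sphere_measure by (rule finite_measure_sphere_measure)
  show ?thesis
    unfolding pair_sigma_finite_def
    using sigma_finite_measure_axioms
      sigma_finite_measure_restrict_space[OF sigma_finite_lborel, of "{0 :: real <..}"] by auto
qed

lemma measurable_flat_exp [measurable]: "flat_exp n \<in> borel_measurable borel"
  unfolding flat_exp_def[abs_def] by measurable

lemma measurable_ident_sphere_measure: "(\<lambda>x. x) \<in> borel_measurable sphere_measure"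
  by (simp add: measurable_cong_sets[OF sets_sphere_measure refl] measurable_restrict_space1)

lemma measurable_ident_time_measure: "(\<lambda>t. t) \<in> borel_measurable time_measure"
  by (simp add: measurable_restrict_space1)

text \<open>The entropy inequality is used only for k = 0 and one \<open>cutoff\<close> per T, for a
  half-space disjoint from \<open>D\<close>.\<close>

lemma AE_entropy_solution_eq_0_half_space:
  assumes sol: "entropy_solution F u0 u"
    and F: "\<And>x u. x \<in> S2 \<Longrightarrow> x \<notin> D \<Longrightarrow> F x u = 0"
    and u0: "AE x in sphere_measure. x \<notin> D \<longrightarrow> u0 x = 0"
    and D: "\<And>x. x \<in> D \<Longrightarrow> a \<bullet> x + b \<le> 0"
  shows "AE (x, t) in sphere_measure \<Otimes>\<^sub>M time_measure. 0 < a \<bullet> x + b \<longrightarrow> u x t = 0"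
proof -
  interpret S: finite_measure sphere_measure by (rule finite_measure_sphere_measure)
  interpret P: pair_sigma_finite sphere_measure time_measure by (rule pair_sigma_finite_sphere_time)
  let ?P = "sphere_measure \<Otimes>\<^sub>M time_measure"
  note [measurable] = measurable_compose[OF measurable_fst measurable_ident_sphere_measure]
    measurable_compose[OF measurable_snd measurable_ident_time_measure]
  have u_meas: "(\<lambda>(x, t). u x t) \<in> borel_measurable ?P"
    using sol by (simp add: entropy_solution_def locally_bounded_in_time_def)
  note [measurable] = u_meas[unfolded case_prod_beta']
  have *: "AE (x, t) in ?P. 0 < a \<bullet> x + b \<and> t < T \<longrightarrow> u x t = 0" if T: "T > 0" for T
  proof -
    \<comment> \<open>This is minus the time term of the entropy integrand, and is
      nonnegative.\<close>
    define g where "g x t = \<bar>u x t\<bar> * (flat_exp 0 (a \<bullet> x + b) * flat_exp 2 (T - t))" for x t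
    have g_nonneg: "0 \<le> g x t" for x t
      by (simp add: g_def flat_exp_nonneg)
    \<comment> \<open>Integrability justifies Fubini and the passage from zero integral to g = 0
      almost everywhere. It holds because g is bounded on the finite-measure set S2 \<times> (0, T)
      and zero elsewhere.\<close>
    have g_int: "integrable ?P (\<lambda>(x, t). g x t)"
    proof -
      obtain C where C: "AE (x, t) in ?P. t < T \<longrightarrow> \<bar>u x t\<bar> \<le> C"
        using sol T unfolding entropy_solution_def locally_bounded_in_time_def by blast
      have flat: "flat_exp 0 s \<le> 1" for s
        by (simp add: flat_exp_def)
      obtain B where B: "flat_exp 2 s \<le> B" if "0 \<le> s" "s \<le> T" for s
      proof -
        have "continuous_on {0..T} (flat_exp 2)"
          by (intro DERIV_continuous_on[where D = "\<lambda>t. flat_exp 4 t - 2 * flat_exp 3 t"]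
              DERIV_subset[OF DERIV_flat_exp[of 2, simplified]]) simp
        then have "bounded (flat_exp 2 ` {0..T})"
          by (intro compact_imp_bounded compact_continuous_image) auto
        then obtain B where "\<forall>s\<in>{0..T}. \<bar>flat_exp 2 s\<bar> \<le> B"
          by (auto simp: bounded_iff)
        then show ?thesis
          using that[of B] by (auto simp: abs_le_iff)
      qed
      have g_le: "g x t \<le> C * B" if "\<bar>u x t\<bar> \<le> C" "0 < t" "t < T" for x t
        unfolding g_def using that flat B[of "T - t"]
          mult_mono[OF flat[of "a \<bullet> x + b"] B[of "T - t"]]
        by (intro mult_mono mult_nonneg_nonneg) (auto simp: flat_exp_nonneg)
      show ?thesis
      proof (rule integrableI_bounded_set[where A = "S2 \<times> {0<..<T}" and B = "C * B"])
        have "S2 \<in> sets sphere_measure" "{0<..<T} \<in> sets time_measure"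
          using sets.top[of sphere_measure] by (auto simp: sets_restrict_space_iff)
        moreover have "emeasure sphere_measure S2 < top"
          using S.emeasure_finite[of S2] by (metis infinity_ennreal_def less_top)
        moreover have "emeasure time_measure {0<..<T} < top"
          using T by (subst emeasure_restrict_space) auto
        ultimately show "S2 \<times> {0<..<T} \<in> sets ?P" "emeasure ?P (S2 \<times> {0<..<T}) < \<infinity>"
          by (auto simp: P.M2.emeasure_pair_measure_Times ennreal_mult_less_top)
        show "(\<lambda>(x, t). g x t) \<in> borel_measurable ?P"
          unfolding g_def case_prod_beta' by measurable
        show "AE z in ?P. z \<in> S2 \<times> {0<..<T} \<longrightarrow> norm (case z of (x, t) \<Rightarrow> g x t) \<le> C * B"
          using C by (rule AE_mp) (auto simp: g_nonneg intro!: AE_I2 g_le)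
        show "AE z in ?P. z \<notin> S2 \<times> {0<..<T} \<longrightarrow> (case z of (x, t) \<Rightarrow> g x t) = 0"
          by (rule AE_I2) (auto simp: space_pair_measure g_def flat_exp_eq_0_iff)
      qed
    qed
    \<comment> \<open>The flux term vanishes pointwise: on \<open>D\<close> through the gradient of
      the cutoff, off \<open>D\<close> through both values of F.\<close>
    have "(LINT x|sphere_measure. \<bar>u x t - 0\<bar> * deriv (\<lambda>s. cutoff a b T x s) t
            + (sgn (u x t - 0) *\<^sub>R (F x (u x t) - F x 0)) \<bullet> tangential_grad (\<lambda>y. cutoff a b T y t) x)
        = (LINT x|sphere_measure. - g x t)" for t
    proof (rule Bochner_Integration.integral_cong[OF refl])
      fix x assume "x \<in> space sphere_measure"
      then have "(sgn (u x t - 0) *\<^sub>R (F x (u x t) - F x 0)) \<bullet> tangential_grad (\<lambda>y. cutoff a b T y t) x = 0"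
        using F[of x] D[of x] tangential_grad_cutoff_eq_0[of a x b T t] by (cases "x \<in> D") auto
      then show "\<bar>u x t - 0\<bar> * deriv (\<lambda>s. cutoff a b T x s) t
            + (sgn (u x t - 0) *\<^sub>R (F x (u x t) - F x 0)) \<bullet> tangential_grad (\<lambda>y. cutoff a b T y t) x
          = - g x t"
        by (simp add: deriv_cutoff g_def)
    qed
    moreover have "(LINT x|sphere_measure. \<bar>u0 x - 0\<bar> * cutoff a b T x 0) = 0"
    proof (rule integral_eq_zero_AE)
      show "AE x in sphere_measure. \<bar>u0 x - 0\<bar> * cutoff a b T x 0 = 0"
        using u0
      proof (rule AE_mp, intro AE_I2 impI)
        fix x assume "x \<notin> D \<longrightarrow> u0 x = 0"
        then show "\<bar>u0 x - 0\<bar> * cutoff a b T x 0 = 0"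
          using D[of x] by (cases "x \<in> D") (auto simp: cutoff_def flat_exp_def)
      qed
    qed
    ultimately have "0 \<le> (LINT t|time_measure. LINT x|sphere_measure. - g x t)"
      using sol[unfolded entropy_solution_def, THEN conjunct2, rule_format,
          OF nonneg_test_function_cutoff, of 0 a b T]
      by simp
    also have "\<dots> = - (LINT z|?P. (case z of (x, t) \<Rightarrow> g x t))"
      using P.integral_snd[OF g_int] by simp
    finally have "(LINT z|?P. (case z of (x, t) \<Rightarrow> g x t)) = 0"
      by (intro antisym Bochner_Integration.integral_nonneg) (auto simp: g_nonneg)
    then have "AE z in ?P. (case z of (x, t) \<Rightarrow> g x t) = 0"
      by (subst (asm) integral_nonneg_eq_0_iff_AE[OF g_int]) (auto simp: g_nonneg)
    then show ?thesis
      by (rule AE_mp) (auto simp: g_def flat_exp_eq_0_iff intro!: AE_I2)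
  qed
  \<comment> \<open>Countably many final times exhaust (0, \<infinity>); \<open>Suc\<close> keeps
    each of them positive.\<close>
  have "AE z in ?P. \<forall>n. 0 < a \<bullet> fst z + b \<and> snd z < real (Suc n) \<longrightarrow> u (fst z) (snd z) = 0"
    unfolding AE_all_countable using *[of "real (Suc _)"] by (simp add: case_prod_beta')
  then show ?thesis
  proof (rule AE_mp, intro AE_I2 impI)
    fix z assume "\<forall>n. 0 < a \<bullet> fst z + b \<and> snd z < real (Suc n) \<longrightarrow> u (fst z) (snd z) = 0"
    moreover obtain n where "snd z < real n"
      using reals_Archimedean2 by blast
    then have "snd z < real (Suc n)"
      by simp
    ultimately show "case z of (x, t) \<Rightarrow> 0 < a \<bullet> x + b \<longrightarrow> u x t = 0"
      unfolding case_prod_beta' by blast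
  qed
qed

section \<open>From half-spaces to the complement of the patch\<close>

lemma AE_pair_sphere_fst:
  assumes "AE x in sphere_measure. Q x" "{x \<in> S2. Q x} \<in> sets sphere_measure"
  shows "AE (x, t) in sphere_measure \<Otimes>\<^sub>M time_measure. Q x"
proof -
  interpret P: pair_sigma_finite sphere_measure time_measure by (rule pair_sigma_finite_sphere_time)
  have "{z \<in> space (sphere_measure \<Otimes>\<^sub>M time_measure). case z of (x, t) \<Rightarrow> Q x}
      = {x \<in> S2. Q x} \<times> space time_measure"
    by (auto simp: space_pair_measure)
  then have "{z \<in> space (sphere_measure \<Otimes>\<^sub>M time_measure). case z of (x, t) \<Rightarrow> Q x}
      \<in> sets (sphere_measure \<Otimes>\<^sub>M time_measure)"
    using assms(2) by (simp only: pair_measureI sets.top)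
  then show ?thesis
    using assms(1) by (intro P.AE_pair_measure) auto
qed

lemma AE_entropy_solution_eq_0_outside_patch:
  assumes sol: "entropy_solution F u0 u"
    and F: "\<And>x u. x \<in> S2 \<Longrightarrow> x \<notin> spherical_patch \<alpha> \<beta> \<Longrightarrow> F x u = 0"
    and u0: "AE x in sphere_measure. x \<notin> spherical_patch \<alpha> \<beta> \<longrightarrow> u0 x = 0"
  shows "AE (x, t) in sphere_measure \<Otimes>\<^sub>M time_measure. x \<notin> spherical_patch \<alpha> \<beta> \<longrightarrow> u x t = 0"
proof -
  let ?P = "sphere_measure \<Otimes>\<^sub>M time_measure"
  \<comment> \<open>The six half-spaces beyond the faces of the cube (\<alpha>, \<beta>)^3 are
    treated separately.\<close>
  have "AE z in ?P. \<alpha> - fst z $ i > 0 \<longrightarrow> u (fst z) (snd z) = 0" for i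
    using AE_entropy_solution_eq_0_half_space[OF sol F u0, of "- axis i 1" \<alpha>]
    by (simp add: spherical_patch_def inner_axis' case_prod_beta' less_imp_le)
  moreover have "AE z in ?P. fst z $ i - \<beta> > 0 \<longrightarrow> u (fst z) (snd z) = 0" for i
    using AE_entropy_solution_eq_0_half_space[OF sol F u0, of "axis i 1" "- \<beta>"]
    by (simp add: spherical_patch_def inner_axis' case_prod_beta' less_imp_le)
  moreover have "AE z in ?P. fst z $ i \<noteq> c" for i c
  proof -
    have "{x \<in> S2. x $ i \<noteq> c} \<in> sets sphere_measure"
      by (auto simp: sets_sphere_measure sets_restrict_space_iff)
    from AE_pair_sphere_fst[OF AE_sphere_measure_component_neq this] show ?thesis
      by (simp add: case_prod_beta')
  qed
  \<comment> \<open>Off the circles, a coordinate outside (\<alpha>, \<beta>) is strictly beyond an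
    endpoint, so the point lies in one of these half-spaces.\<close>
  ultimately have "AE z in ?P. \<forall>i\<in>UNIV.
      (\<alpha> - fst z $ i > 0 \<longrightarrow> u (fst z) (snd z) = 0) \<and> (fst z $ i - \<beta> > 0 \<longrightarrow> u (fst z) (snd z) = 0)
        \<and> fst z $ i \<noteq> \<alpha> \<and> fst z $ i \<noteq> \<beta>"
    by (subst AE_finite_all) (simp_all add: AE_conj_iff)
  then show ?thesis
    by (rule AE_mp)
      (auto simp: spherical_patch_def space_pair_measure not_less le_less intro!: AE_I2)
qed

text \<open>A space-time null set may contain a whole time slice. Fubini makes v vanish off
  \<open>D\<close> at almost every time, and L1 continuity carries this over to each t by
  approximation with such times.\<close>

lemma AE_L1_continuous_representative_eq_0:
  assumes rep: "L1_continuous_representative u v"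
    and u: "AE (x, t) in sphere_measure \<Otimes>\<^sub>M time_measure. x \<notin> D \<longrightarrow> u x t = 0"
    and D: "S2 - D \<in> sets sphere_measure" and "t \<ge> 0"
  shows "AE x in sphere_measure. x \<notin> D \<longrightarrow> v x t = 0"
proof -
  interpret P: pair_sigma_finite sphere_measure time_measure by (rule pair_sigma_finite_sphere_time)
  interpret Q: pair_sigma_finite time_measure sphere_measure ..
  let ?P = "sphere_measure \<Otimes>\<^sub>M time_measure"
  have int: "integrable sphere_measure (\<lambda>x. v x s)" if "s \<ge> 0" for s
    using rep that by (simp add: L1_continuous_representative_def)
  have "AE (x, t) in ?P. v x t = u x t"
    using rep by (simp add: L1_continuous_representative_def)
  with u have "AE z in ?P. fst z \<notin> D \<longrightarrow> v (fst z) (snd z) = 0"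
    by eventually_elim auto
  \<comment> \<open>Time becomes the first factor, so that slicing yields a statement for almost
    every time.\<close>
  then have "AE z in time_measure \<Otimes>\<^sub>M sphere_measure. snd z \<notin> D \<longrightarrow> v (snd z) (fst z) = 0"
    by (subst (asm) P.distr_pair_swap, drule_tac AE_distrD[OF measurable_pair_swap'])
      (simp add: case_prod_beta')
  from Q.AE_pair[OF this] have good: "AE s in lborel. 0 < s \<longrightarrow> (AE x in sphere_measure. x \<notin> D \<longrightarrow> v x s = 0)"
    by (simp add: AE_restrict_space_iff)
  define I where "I = (LINT x|sphere_measure. indicator (S2 - D) x * \<bar>v x t\<bar>)"
  have I_int: "integrable sphere_measure (\<lambda>x. indicator (S2 - D) x * \<bar>v x t\<bar>)"
    using integrable_mult_indicator[OF D integrable_abs[OF int[OF \<open>t \<ge> 0\<close>]]] by simp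
  have "I \<le> 0"
  proof (rule ccontr)
    assume "\<not> I \<le> 0"
    moreover have "((\<lambda>s. LINT x|sphere_measure. \<bar>v x s - v x t\<bar>) \<longlongrightarrow> 0) (at t within {0..})"
      using rep \<open>t \<ge> 0\<close> by (simp add: L1_continuous_representative_def)
    ultimately have "\<forall>\<^sub>F s in at t within {0..}. (LINT x|sphere_measure. \<bar>v x s - v x t\<bar>) < I"
      by (intro order_tendstoD) auto
    then obtain e where e: "e > 0"
      "\<And>s. s \<ge> 0 \<Longrightarrow> s \<noteq> t \<Longrightarrow> dist s t < e \<Longrightarrow> (LINT x|sphere_measure. \<bar>v x s - v x t\<bar>) < I"
      by (auto simp: eventually_at)
    \<comment> \<open>The interval (t, t + e) has positive length and so contains a good time;
      approaching from the right also covers t = 0.\<close>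
    obtain s where s: "t < s" "s < t + e" "AE x in sphere_measure. x \<notin> D \<longrightarrow> v x s = 0"
    proof (rule ccontr)
      assume "\<not> thesis"
      then have "AE s in lborel. s \<notin> {t<..<t + e}"
        using good that \<open>t \<ge> 0\<close> by (auto elim!: eventually_mono)
      then have "{t<..<t + e} \<in> null_sets lborel"
        by (subst AE_iff_null_sets) auto
      with \<open>e > 0\<close> show False
        by (simp add: null_sets_def)
    qed
    have "I \<le> (LINT x|sphere_measure. \<bar>v x s - v x t\<bar>)"
      unfolding I_def
    proof (rule integral_mono_AE[OF I_int])
      show "integrable sphere_measure (\<lambda>x. \<bar>v x s - v x t\<bar>)"
        using s \<open>t \<ge> 0\<close> by (intro integrable_abs Bochner_Integration.integrable_diff int) auto
      \<comment> \<open>Off \<open>D\<close> the value v x s is zero, so the two sides agree there;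
        on \<open>D\<close> the left side is zero.\<close>
      show "AE x in sphere_measure. indicator (S2 - D) x * \<bar>v x t\<bar> \<le> \<bar>v x s - v x t\<bar>"
        using s(3) by eventually_elim (auto split: split_indicator)
    qed
    with e(2)[of s] s \<open>t \<ge> 0\<close> show False
      by (auto simp: dist_real_def)
  qed
  then have "I = 0"
    unfolding I_def by (intro antisym Bochner_Integration.integral_nonneg) auto
  then have "AE x in sphere_measure. indicator (S2 - D) x * \<bar>v x t\<bar> = 0"
    unfolding I_def by (subst (asm) integral_nonneg_eq_0_iff_AE[OF I_int]) auto
  then show ?thesis
    by (rule AE_mp) (auto simp: indicator_def intro!: AE_I2)
qed

lemma sets_diff_spherical_patch: "S2 - spherical_patch \<alpha> \<beta> \<in> sets sphere_measure"
proof -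
  have "open {x :: real^3. \<forall>i. \<alpha> < x $ i \<and> x $ i < \<beta>}"
    unfolding Collect_all_eq
    by (intro open_INT ballI finite open_Collect_conj open_Collect_less continuous_intros)
  moreover have "S2 - spherical_patch \<alpha> \<beta> = S2 - {x. \<forall>i. \<alpha> < x $ i \<and> x $ i < \<beta>}"
    by (auto simp: spherical_patch_def)
  ultimately show ?thesis
    by (auto simp: sets_sphere_measure sets_restrict_space_iff)
qed

theorem claim3p7:
  fixes \<alpha> \<beta> :: real and \<psi> f :: "real \<Rightarrow> real"
    and h :: "real^3 \<Rightarrow> real \<Rightarrow> real" and F :: "real^3 \<Rightarrow> real \<Rightarrow> real^3"
    and D :: "(real^3) set" and u0 :: "real^3 \<Rightarrow> real" and u :: "real^3 \<Rightarrow> real \<Rightarrow> real"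
  assumes "{\<alpha><..<\<beta>} \<subseteq> {0<..<1}" and "3 * \<beta>\<^sup>2 > 1" and "3 * \<alpha>\<^sup>2 < 1"
    and "C_diff 2 \<psi>" and "\<forall>s. s \<notin> {\<alpha><..<\<beta>} \<longrightarrow> \<psi> s = 0"
    and "smooth f"
    and "\<forall>x u. h x u = \<psi> (x $ 1) * \<psi> (x $ 2) * \<psi> (x $ 3) * f u"
    and "F = gradient_flux h"
    and "D = spherical_patch \<alpha> \<beta>"
    and "bounded_measurable_initial_data u0"
    and "AE x in sphere_measure. x \<notin> D \<longrightarrow> u0 x = 0"
    and "entropy_solution F u0 u"
  shows "(AE (x, t) in sphere_measure \<Otimes>\<^sub>M time_measure. x \<notin> D \<longrightarrow> u x t = 0) \<and>
    (\<forall>v. L1_continuous_representative u v \<longrightarrow>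
       (\<forall>t\<ge>0. AE x in sphere_measure. x \<notin> D \<longrightarrow> v x t = 0))"
proof -
  have "\<forall>s. \<psi> differentiable (at s)"
    using assms(4) by (simp add: numeral_2_eq_2)
  then have F: "F x u = 0" if "x \<in> S2" "x \<notin> spherical_patch \<alpha> \<beta>" for x u
    using gradient_flux_eq_0[of \<psi> \<alpha> \<beta> h f x u] that assms(5,7,8) by simp
  have u: "AE (x, t) in sphere_measure \<Otimes>\<^sub>M time_measure. x \<notin> D \<longrightarrow> u x t = 0"
    using AE_entropy_solution_eq_0_outside_patch[OF assms(12) F] assms(9,11) by blast
  then show ?thesis
    using AE_L1_continuous_representative_eq_0[OF _ u] sets_diff_spherical_patch assms(9) by blast
qed

end
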